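(* For all integers $m,n\ge 2$, $\rho(T_{m,n})=\rho(\widehat{T}_{m,n})$, where $\rho$ denotes the spectral radius, $T_{m,n}$ is the transfer matrix and $\widehat{T}_{m,n}$ its $G_{m,n}$-compressed version.
   Context: For integers $m,n\ge2$, let $V_{m,n}:=\mathbb{Z}/m\mathbb{Z}\times\mathbb{Z}/n\mathbb{Z}$ with componentwise addition, and $D:=\{(0,0),(1,0),(0,1)\}\subset V_{m,n}$. The matrix $A_{m,n}$, with rows and columns indexed by $V_{m,n}$, has entries $A_{m,n}(\mathbf{u},\mathbf{v})=1$ if $\mathbf{v}-\mathbf{u}\in D$ and $0$ otherwise. For $R,C\subseteq V_{m,n}$, $A_{m,n}[R,C]$ is the submatrix with row set $R$ and column set $C$. The matrix $T_{m,n}$, with rows and columns indexed by the power set $2^{V_{m,n}}$, has entries $$T_{m,n}(U,V):=\begin{cases}\operatorname{per}A_{m,n}[U,V_{m,n}\setminus V] & \text{if }|U|+|V|=mn,\\ 0&\text{otherwise,}\end{cases}$$ where for $|R|=|C|$, $\operatorname{per}A_{m,n}[R,C]=\sum_{\sigma:R\to C\text{ bijection}}\prod_{\mathbf{u}\in R}A_{m,n}(\mathbf{u},\sigma(\mathbf{u}))$ is the permanent, and the permanent of the empty matrix is $1$. Let $K_{m,n}:=\{\varphi\in\operatorname{Aut}(V_{m,n}) : \text{there exists }\mathbf{t}_\varphi\in V_{m,n}\text{ such that }\varphi(D)=\mathbf{t}_\varphi+D\}$, where $\operatorname{Aut}(V_{m,n})$ is the group of group automorphisms, and let $G_{m,n}:=V_{m,n}\rtimes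 K_{m,n}$, with $K_{m,n}$ acting on $V_{m,n}$ in the natural way. $G_{m,n}$ acts on $V_{m,n}$ by $(\mathbf{u},\varphi)\cdot\mathbf{v}:=\mathbf{u}+\varphi(\mathbf{v})$, and hence on subsets of $V_{m,n}$ elementwise; $2^{V_{m,n}}/G_{m,n}$ denotes the set of orbits of subsets. The $G_{m,n}$-compressed matrix $\widehat{T}_{m,n}$ has rows and columns indexed by $2^{V_{m,n}}/G_{m,n}$ and entries $\widehat{T}_{m,n}(\mathcal{O}_1,\mathcal{O}_2):=\sum_{V\in\mathcal{O}_2}T_{m,n}(U,V)$ for any $U\in\mathcal{O}_1$; the value does not depend on the choice of $U\in\mathcal{O}_1$. *)

theory Defs
  imports
    "HOL-Algebra.Elementary_Groups"
    "HOL-Algebra.Group_Action"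
    "HOL-Library.Countable_Set"
    "Jordan_Normal_Form.Spectral_Radius"
begin

section \<open>Matrices indexed by finite sets\<close>

definition permanent :: "('i \<Rightarrow> 'j \<Rightarrow> 'a :: comm_semiring_1) \<Rightarrow> 'i set \<Rightarrow> 'j set \<Rightarrow> 'a" where
  "permanent A R C = (\<Sum>\<sigma> \<in> {\<sigma> \<in> R \<rightarrow>\<^sub>E C. bij_betw \<sigma> R C}. \<Prod>u\<in>R. A u (\<sigma> u))"

lemma permanent_empty: "permanent A {} {} = 1"
  by (simp add: permanent_def bij_betw_def inj_on_def Collect_conv_if cong: conj_cong)

definition matrix_by :: "(nat \<Rightarrow> 'i) \<Rightarrow> 'i set \<Rightarrow> ('i \<Rightarrow> 'i \<Rightarrow> 'a) \<Rightarrow> 'a mat" where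
  "matrix_by e I M = mat (card I) (card I) (\<lambda>(i, j). M (e i) (e j))"

text \<open>
  A matrix with rows and columns indexed by a finite set is turned into a library matrix
  through an enumeration of the index set; the choice of the enumeration is irrelevant for the
  spectrum, see \<open>spectrum_matrix_on\<close> and \<open>spectral_radius_matrix_by\<close> below.
\<close>

definition matrix_on :: "'i set \<Rightarrow> ('i \<Rightarrow> 'i \<Rightarrow> 'a) \<Rightarrow> 'a mat" where
  "matrix_on I M = matrix_by (from_nat_into I) I M"

lemma eigenvalue_matrix_by_iff:
  fixes M :: "'i \<Rightarrow> 'i \<Rightarrow> 'a :: field"
  assumes e: "bij_betw e {..<card I} I"
  shows "eigenvalue (matrix_by e I M) k \<longleftrightarrow>
    (\<exists>x. (\<exists>i\<in>I. x i \<noteq> 0) \<and> (\<forall>i\<in>I. (\<Sum>j\<in>I. M i j * x j) = k * x i))"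
proof
  let ?A = "matrix_by e I M" and ?n = "card I"
  let ?e' = "inv_into {..<?n} e"
  have A: "?A \<in> carrier_mat ?n ?n"
    by (simp add: matrix_by_def)
  {
    assume "eigenvalue ?A k"
    then obtain v where v: "v \<in> carrier_vec ?n" "v \<noteq> 0\<^sub>v ?n" "?A *\<^sub>v v = k \<cdot>\<^sub>v v"
      using A by (auto simp: eigenvalue_def eigenvector_def)
    define x where "x = (\<lambda>i. v $ ?e' i)"
    have xe: "x (e l) = v $ l" if "l < ?n" for l
      using that bij_betw_inv_into_left[OF e, of l] by (simp add: x_def)
    have "\<exists>l<?n. v $ l \<noteq> 0"
    proof (rule ccontr)
      assume "\<not> ?thesis"
      then have "v = 0\<^sub>v ?n"
        using v(1) by (intro eq_vecI) auto
      with v(2) show False ..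
    qed
    then have 1: "\<exists>i\<in>I. x i \<noteq> 0"
      using xe bij_betwE[OF e] by (metis lessThan_iff)
    have 2: "(\<Sum>j\<in>I. M i j * x j) = k * x i" if "i \<in> I" for i
    proof -
      obtain l where l: "l < ?n" "i = e l"
        using \<open>i \<in> I\<close> e unfolding bij_betw_def by auto
      have "(\<Sum>j\<in>I. M i j * x j) = (\<Sum>j<?n. M i (e j) * x (e j))"
        by (rule sum.reindex_bij_betw[OF e, symmetric])
      also have "\<dots> = (?A *\<^sub>v v) $ l"
        using l v(1) xe by (auto simp: matrix_by_def scalar_prod_def lessThan_atLeast0 intro!: sum.cong)
      also have "\<dots> = k * x i"
        using l v xe by simp
      finally show ?thesis .
    qed
    from 1 2 show "\<exists>x. (\<exists>i\<in>I. x i \<noteq> 0) \<and> (\<forall>i\<in>I. (\<Sum>j\<in>I. M i j * x j) = k * x i)"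
      by blast
  next
    assume "\<exists>x. (\<exists>i\<in>I. x i \<noteq> 0) \<and> (\<forall>i\<in>I. (\<Sum>j\<in>I. M i j * x j) = k * x i)"
    then obtain x i where x: "i \<in> I" "x i \<noteq> 0"
      and eq: "\<And>i. i \<in> I \<Longrightarrow> (\<Sum>j\<in>I. M i j * x j) = k * x i"
      by blast
    define v where "v = vec ?n (\<lambda>l. x (e l))"
    obtain l where l: "l < ?n" "i = e l"
      using x(1) e unfolding bij_betw_def by auto
    have "v \<noteq> 0\<^sub>v ?n"
    proof
      assume "v = 0\<^sub>v ?n"
      then have "v $ l = 0\<^sub>v ?n $ l"
        by simp
      with l x(2) show False
        by (simp add: v_def)
    qed
    moreover have "?A *\<^sub>v v = k \<cdot>\<^sub>v v"
    proof (rule eq_vecI)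
      fix l assume "l < dim_vec (k \<cdot>\<^sub>v v)"
      then have l: "l < ?n"
        by (simp add: v_def)
      have "(?A *\<^sub>v v) $ l = (\<Sum>j<?n. M (e l) (e j) * x (e j))"
        using l by (auto simp: matrix_by_def v_def scalar_prod_def lessThan_atLeast0 intro!: sum.cong)
      also have "\<dots> = (\<Sum>j\<in>I. M (e l) j * x j)"
        by (rule sum.reindex_bij_betw[OF e])
      also have "\<dots> = k * x (e l)"
        using l bij_betwE[OF e] by (intro eq) auto
      finally show "(?A *\<^sub>v v) $ l = (k \<cdot>\<^sub>v v) $ l"
        using l by (simp add: v_def)
    qed (simp add: matrix_by_def v_def)
    ultimately show "eigenvalue ?A k"
      unfolding eigenvalue_def eigenvector_def
      by (intro exI[of _ v]) (simp add: v_def matrix_by_def)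
  }
qed

lemma spectrum_matrix_on:
  fixes M :: "'i \<Rightarrow> 'i \<Rightarrow> 'a :: field"
  assumes "finite I"
  shows "spectrum (matrix_on I M) =
    {k. \<exists>x. (\<exists>i\<in>I. x i \<noteq> 0) \<and> (\<forall>i\<in>I. (\<Sum>j\<in>I. M i j * x j) = k * x i)}"
  unfolding spectrum_def matrix_on_def
  by (intro Collect_cong eigenvalue_matrix_by_iff bij_betw_from_nat_into_finite assms)

lemma spectral_radius_matrix_by:
  assumes "finite I" "bij_betw e {..<card I} I"
  shows "spectral_radius (matrix_by e I M) = spectral_radius (matrix_on I M)"
proof -
  have "spectrum (matrix_by e I M) = spectrum (matrix_on I M)"
    unfolding spectrum_matrix_on[OF assms(1)] unfolding spectrum_def
    by (intro Collect_cong eigenvalue_matrix_by_iff assms(2))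
  then show ?thesis
    by (simp add: spectral_radius_def)
qed


section \<open>The transfer matrix\<close>

text \<open>The group \<open>\<int>/m\<int> \<times> \<int>/n\<int>\<close>, written multiplicatively as everywhere in \<open>HOL-Algebra\<close>.\<close>

definition torus :: "nat \<Rightarrow> nat \<Rightarrow> (int \<times> int) monoid" where
  "torus m n = integer_mod_group m \<times>\<times> integer_mod_group n"

definition dirs :: "(int \<times> int) set" where
  "dirs = {(0, 0), (1, 0), (0, 1)}"

definition adj :: "nat \<Rightarrow> nat \<Rightarrow> int \<times> int \<Rightarrow> int \<times> int \<Rightarrow> complex" where
  "adj m n u v = (if v \<otimes>\<^bsub>torus m n\<^esub> inv\<^bsub>torus m n\<^esub> u \<in> dirs then 1 else 0)"

definition transfer :: "nat \<Rightarrow> nat \<Rightarrow> (int \<times> int) set \<Rightarrow> (int \<times> int) set \<Rightarrow> complex" where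
  "transfer m n U V =
    (if card U + card V = m * n then permanent (adj m n) U (carrier (torus m n) - V) else 0)"

definition transfer_mat :: "nat \<Rightarrow> nat \<Rightarrow> complex mat" where
  "transfer_mat m n = matrix_on (Pow (carrier (torus m n))) (transfer m n)"


section \<open>The symmetry group and the compressed transfer matrix\<close>

definition dirs_stab :: "nat \<Rightarrow> nat \<Rightarrow> (int \<times> int \<Rightarrow> int \<times> int) set" where
  "dirs_stab m n = {\<phi> \<in> auto (torus m n).
     \<exists>t \<in> carrier (torus m n). \<phi> ` dirs = t <#\<^bsub>torus m n\<^esub> dirs}"

definition sym_group ::
  "nat \<Rightarrow> nat \<Rightarrow> ((int \<times> int) \<times> (int \<times> int \<Rightarrow> int \<times> int)) monoid" where
  "sym_group m n =
    \<lparr>carrier = carrier (torus m n) \<times> dirs_stab m n,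
     monoid.mult = (\<lambda>(u, \<phi>) (v, \<psi>).
       (u \<otimes>\<^bsub>torus m n\<^esub> \<phi> v, \<phi> \<otimes>\<^bsub>AutoGroup (torus m n)\<^esub> \<psi>)),
     one = (\<one>\<^bsub>torus m n\<^esub>, \<one>\<^bsub>AutoGroup (torus m n)\<^esub>)\<rparr>"

definition sym_act ::
  "nat \<Rightarrow> nat \<Rightarrow> (int \<times> int) \<times> (int \<times> int \<Rightarrow> int \<times> int) \<Rightarrow> int \<times> int \<Rightarrow> int \<times> int" where
  "sym_act m n g v = (case g of (u, \<phi>) \<Rightarrow> u \<otimes>\<^bsub>torus m n\<^esub> \<phi> v)"

definition subset_orbits :: "nat \<Rightarrow> nat \<Rightarrow> (int \<times> int) set set set" where
  "subset_orbits m n =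
    orbits (sym_group m n) (Pow (carrier (torus m n))) (\<lambda>g U. sym_act m n g ` U)"

text \<open>The row sum is the same for every representative \<open>U\<close> of the orbit \<open>O1\<close>.\<close>

definition compressed_transfer ::
  "nat \<Rightarrow> nat \<Rightarrow> (int \<times> int) set set \<Rightarrow> (int \<times> int) set set \<Rightarrow> complex" where
  "compressed_transfer m n O1 O2 = (\<Sum>V\<in>O2. transfer m n (SOME U. U \<in> O1) V)"

definition compressed_transfer_mat :: "nat \<Rightarrow> nat \<Rightarrow> complex mat" where
  "compressed_transfer_mat m n = matrix_on (subset_orbits m n) (compressed_transfer m n)"

end

theory Submission
  imports Defs "HOL-Library.Disjoint_Sets" "HOL-Library.Nonpos_Ints"
begin

text \<open>
  The symmetry group cuts the subsets of the torus into orbits, and summing the transfer matrix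
  \<open>T\<close> along an orbit of columns gives the same value for every row of an orbit: the orbits form
  an equitable partition, with the compressed matrix \<open>Q\<close> as quotient. Consequently \<open>T\<close>, applied
  to a function that is constant on orbits, acts as \<open>Q\<close> does on the induced function on orbits.

  An eigenvector of \<open>Q\<close> thus lifts to an eigenvector of \<open>T\<close>, so the spectrum of \<open>Q\<close> is
  contained in that of \<open>T\<close> (\<open>spectrum_quotient_subset\<close>) and \<open>\<rho>(Q) \<le> \<rho>(T)\<close>. An eigenvector of
  \<open>T\<close> for an eigenvalue of maximal modulus need not be constant on orbits, so the converse
  inequality uses that \<open>T\<close> has nonnegative entries. The usual argument takes a Perron vector and
  averages it over the group; comparing growth rates avoids Perron-Frobenius theory. If
  \<open>T x = \<mu> x\<close> with \<open>\<bar>\<mu>\<bar> = \<rho>(T)\<close>, the triangle inequality gives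
  \<open>\<rho>(T)^k \<bar>x i\<bar> \<le> b (T^k 1) i\<close>, where \<open>b\<close> bounds the entries of \<open>x\<close>
  (\<open>eigenvector_le_iterate_one\<close>). The constant function \<open>1\<close> is constant on orbits, so \<open>T^k 1\<close>
  is the lift of \<open>Q^k 1\<close>, which is \<open>O(t^k)\<close> for every positive \<open>t > \<rho>(Q)\<close>
  (\<open>mult_on_funpow_growth\<close>, a consequence of the Jordan normal form). With \<open>\<rho>(Q) < t < \<rho>(T)\<close>
  this is absurd for large \<open>k\<close>. The argument is carried out for arbitrary equitable partitions
  in \<open>spectral_radius_quotient\<close>.

  The partition is equitable although \<open>T\<close> is not invariant under the group. If the automorphism
  \<open>\<phi>\<close> maps the directions \<open>D\<close> to \<open>t + D\<close>, then \<open>w - v \<in> D\<close> is equivalent to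
  \<open>(\<phi> w - t) - \<phi> v \<in> D\<close>: moving the rows by \<open>g = (u, \<phi>)\<close> has to be matched by moving the
  columns by \<open>h = (u - t, \<phi>)\<close> (\<open>shape_stab_difference\<close>, \<open>transfer_twist\<close>). Since \<open>h\<close> lies in the
  group as well, it permutes every orbit of columns, which is all that the row sums need
  (\<open>equitable_partition_orbits\<close>).
\<close>

section \<open>Powers of a matrix below the spectral radius\<close>

text \<open>
  The matrix-vector product, on functions rather than on vectors over an enumeration of the
  index set: iterates over a set and over a partition of it can then be compared directly.
\<close>

definition mult_on :: "'i set \<Rightarrow> ('i \<Rightarrow> 'i \<Rightarrow> 'a :: semiring_0) \<Rightarrow> ('i \<Rightarrow> 'a) \<Rightarrow> 'i \<Rightarrow> 'a" where
  "mult_on I M x = (\<lambda>i. \<Sum>j\<in>I. M i j * x j)"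

lemma mult_on_cong: "(\<And>j. j \<in> I \<Longrightarrow> x j = y j) \<Longrightarrow> mult_on I M x = mult_on I M y"
  by (simp add: mult_on_def)

lemma mult_on_funpow_scale:
  fixes M :: "'i \<Rightarrow> 'i \<Rightarrow> 'a :: field"
  shows "(mult_on I (\<lambda>i j. M i j / t) ^^ k) x i = (mult_on I M ^^ k) x i / t ^ k"
proof (induction k arbitrary: i)
  case (Suc k)
  then show ?case
    by (simp add: mult_on_def sum_divide_distrib mult.commute)
qed simp

lemma pow_matrix_by_mult_vec:
  fixes M :: "'i \<Rightarrow> 'i \<Rightarrow> 'a :: comm_ring_1"
  assumes e: "bij_betw e {..<card I} I"
  shows "(matrix_by e I M ^\<^sub>m k) *\<^sub>v vec (card I) (\<lambda>l. x (e l)) =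
    vec (card I) (\<lambda>l. (mult_on I M ^^ k) x (e l))"
proof (induction k arbitrary: x)
  case 0
  show ?case
    by (simp add: matrix_by_def)
next
  case (Suc k)
  let ?A = "matrix_by e I M" and ?n = "card I"
  have A: "?A \<in> carrier_mat ?n ?n"
    by (simp add: matrix_by_def)
  have step: "?A *\<^sub>v vec ?n (\<lambda>l. x (e l)) = vec ?n (\<lambda>l. mult_on I M x (e l))"
  proof (rule eq_vecI)
    fix l assume "l < dim_vec (vec ?n (\<lambda>l. mult_on I M x (e l)))"
    then have l: "l < ?n"
      by simp
    then have "(?A *\<^sub>v vec ?n (\<lambda>l. x (e l))) $ l = (\<Sum>j<?n. M (e l) (e j) * x (e j))"
      by (auto simp: matrix_by_def scalar_prod_def lessThan_atLeast0 intro!: sum.cong)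
    also have "\<dots> = (\<Sum>j\<in>I. M (e l) j * x j)"
      by (rule sum.reindex_bij_betw[OF e])
    finally show "(?A *\<^sub>v vec ?n (\<lambda>l. x (e l))) $ l = vec ?n (\<lambda>l. mult_on I M x (e l)) $ l"
      using l by (simp add: mult_on_def)
  qed (simp add: matrix_by_def)
  have "(?A ^\<^sub>m Suc k) *\<^sub>v vec ?n (\<lambda>l. x (e l)) = ?A ^\<^sub>m k *\<^sub>v (?A *\<^sub>v vec ?n (\<lambda>l. x (e l)))"
    using A by (simp add: assoc_mult_mat_vec[where n\<^sub>1 = ?n and n\<^sub>2 = ?n and n\<^sub>3 = ?n])
  then show ?case
    unfolding step Suc.IH by (simp add: funpow_swap1)
qed

lemma matrix_on_carrier: "matrix_on I M \<in> carrier_mat (card I) (card I)"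
  by (simp add: matrix_on_def matrix_by_def)

lemma finite_spectrum_matrix_on: "finite (spectrum (matrix_on I M :: complex mat))"
  using card_finite_spectrum[OF matrix_on_carrier] by blast

lemma spectral_radius_matrix_on_attained:
  fixes M :: "'i \<Rightarrow> 'i \<Rightarrow> complex"
  assumes "finite I" "I \<noteq> {}"
  obtains k where "k \<in> spectrum (matrix_on I M)" "norm k = spectral_radius (matrix_on I M)"
proof -
  have "card I > 0"
    using assms by (simp add: card_gt_0_iff)
  from spectral_radius_mem_max(1)[OF matrix_on_carrier this] show ?thesis
    using that by (metis imageE)
qed

lemma norm_le_spectral_radius_matrix_on:
  "k \<in> spectrum (matrix_on I M) \<Longrightarrow> norm k \<le> spectral_radius (matrix_on I M)"
  by (simp add: spectral_radius_def finite_spectrum_matrix_on)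

text \<open>
  Dividing the matrix by \<open>t\<close> pushes its spectral radius below \<open>1\<close>, and the powers of such a matrix
  are bounded, as its Jordan normal form shows.
\<close>

lemma mult_on_funpow_growth:
  fixes M :: "'i \<Rightarrow> 'i \<Rightarrow> complex" and t :: real
  assumes fin: "finite I" and rho: "spectral_radius (matrix_on I M) < t" and t: "t > 0"
  obtains c where "\<And>k i. i \<in> I \<Longrightarrow> norm ((mult_on I M ^^ k) x i) \<le> c * t ^ k"
proof (cases "I = {}")
  case True
  then show ?thesis
    using that by simp
next
  case False
  let ?n = "card I" and ?e = "from_nat_into I"
  define N where "N = matrix_on I (\<lambda>i j. M i j / of_real t)"
  have e: "bij_betw ?e {..<?n} I"
    by (rule bij_betw_from_nat_into_finite[OF fin])
  have N: "N \<in> carrier_mat ?n ?n"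
    by (simp add: N_def matrix_on_carrier)
  \<comment> \<open>The largest eigenvalue of \<open>N\<close>, multiplied by \<open>t\<close>, is an eigenvalue of the original matrix.\<close>
  obtain k where k: "k \<in> spectrum N" "norm k = spectral_radius N"
    unfolding N_def using spectral_radius_matrix_on_attained[OF fin False] by metis
  have "of_real t * k \<in> spectrum (matrix_on I M)"
  proof -
    from k(1) obtain y where y: "\<exists>i\<in>I. y i \<noteq> 0"
      "\<And>i. i \<in> I \<Longrightarrow> (\<Sum>j\<in>I. M i j / of_real t * y j) = k * y i"
      unfolding N_def spectrum_matrix_on[OF fin] by blast
    have "(\<Sum>j\<in>I. M i j * y j) = of_real t * k * y i" if "i \<in> I" for i
    proof -
      have "(\<Sum>j\<in>I. M i j * y j) = of_real t * (\<Sum>j\<in>I. M i j / of_real t * y j)"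
        using t by (simp add: sum_distrib_left)
      then show ?thesis
        using y(2)[OF that] by simp
    qed
    with y(1) show ?thesis
      unfolding spectrum_matrix_on[OF fin] by blast
  qed
  from norm_le_spectral_radius_matrix_on[OF this] t
  have "norm k * t \<le> spectral_radius (matrix_on I M)"
    by (simp add: norm_mult mult.commute[of t])
  with rho have "norm k * t < 1 * t"
    by linarith
  with t have "norm k < 1"
    using mult_less_cancel_right_pos by blast
  with k(2) have "spectral_radius N < 1"
    by simp
  from spectral_radius_jnf_norm_bound_less_1_upper_triangular[OF N this]
  obtain b where b: "\<And>k. norm_bound (N ^\<^sub>m k) b"
    by blast
  define c where "c = (\<Sum>l<?n. b * norm (x (?e l)))"
  have "norm ((mult_on I M ^^ k) x i) \<le> c * t ^ k" if i: "i \<in> I" for k i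
  proof -
    obtain l where l: "l < ?n" "i = ?e l"
      using i e unfolding bij_betw_def by auto
    have dim: "dim_row (N ^\<^sub>m k) = ?n" "dim_col (N ^\<^sub>m k) = ?n"
      using N by auto
    have "(mult_on I M ^^ k) x i / of_real t ^ k =
        ((N ^\<^sub>m k) *\<^sub>v vec ?n (\<lambda>l. x (?e l))) $ l"
      unfolding N_def matrix_on_def pow_matrix_by_mult_vec[OF e]
      using l by (simp add: mult_on_funpow_scale)
    also have "\<dots> = (\<Sum>j<?n. (N ^\<^sub>m k) $$ (l, j) * x (?e j))"
      using l dim by (auto simp: scalar_prod_def lessThan_atLeast0 intro!: sum.cong)
    finally have "norm ((mult_on I M ^^ k) x i / of_real t ^ k) \<le>
        (\<Sum>j<?n. norm ((N ^\<^sub>m k) $$ (l, j) * x (?e j)))"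
      by (simp only: norm_sum)
    also have "\<dots> \<le> c"
      unfolding c_def using b[of k] l dim
      by (intro sum_mono) (auto simp: norm_mult norm_bound_def intro!: mult_right_mono)
    finally show ?thesis
      using t by (simp add: norm_divide norm_power divide_le_eq)
  qed
  then show ?thesis
    by (rule that)
qed


section \<open>Equitable partitions\<close>

locale equitable_partition =
  fixes I :: "'i set" and P :: "'i set set" and M :: "'i \<Rightarrow> 'i \<Rightarrow> complex"
    and Q :: "'i set \<Rightarrow> 'i set \<Rightarrow> complex"
  assumes finite_index: "finite I"
    and partition: "partition_on I P"
    and row_sum: "\<And>p q i. p \<in> P \<Longrightarrow> q \<in> P \<Longrightarrow> i \<in> p \<Longrightarrow> (\<Sum>j\<in>q. M i j) = Q p q"
begin

definition part_of :: "'i \<Rightarrow> 'i set" where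
  "part_of i = (THE p. p \<in> P \<and> i \<in> p)"

lemma part_of_eq: "p \<in> P \<Longrightarrow> i \<in> p \<Longrightarrow> part_of i = p"
  unfolding part_of_def using partition
  by (intro the_equality) (auto simp: partition_on_def disjoint_def)

lemma part_of_in: "i \<in> I \<Longrightarrow> part_of i \<in> P" "i \<in> I \<Longrightarrow> i \<in> part_of i"
  using part_of_eq partition by (auto simp: partition_on_def)

lemma finite_parts: "finite P"
  using finite_elements[OF finite_index partition] .

text \<open>
  Lifting functions from parts to indices intertwines the two matrices: grouping the sum over all
  columns by parts leaves exactly the row sums that define the quotient.
\<close>

lemma mult_on_lift:
  assumes i: "i \<in> I"
  shows "mult_on I M (\<lambda>i. y (part_of i)) i = mult_on P Q y (part_of i)"
proof -
  have I: "I = \<Union>P"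
    using partition by (rule partition_onD1)
  have "mult_on I M (\<lambda>i. y (part_of i)) i = (\<Sum>q\<in>P. \<Sum>j\<in>q. M i j * y (part_of j))"
    unfolding mult_on_def I
    by (subst sum.Union_disjoint)
      (use partition finite_index in
        \<open>auto simp: partition_on_def disjoint_def intro: finite_subset[OF Union_upper]\<close>)
  also have "\<dots> = (\<Sum>q\<in>P. (\<Sum>j\<in>q. M i j) * y q)"
    by (simp add: sum_distrib_right part_of_eq)
  also have "\<dots> = mult_on P Q y (part_of i)"
    using row_sum[OF part_of_in(1)[OF i] _ part_of_in(2)[OF i]] by (simp add: mult_on_def)
  finally show ?thesis .
qed

lemma mult_on_funpow_lift:
  "i \<in> I \<Longrightarrow> (mult_on I M ^^ k) (\<lambda>i. y (part_of i)) i = (mult_on P Q ^^ k) y (part_of i)"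
proof (induction k arbitrary: i)
  case (Suc k)
  then show ?case
    using mult_on_cong[OF Suc.IH, where M = M] mult_on_lift by simp
qed simp

lemma spectrum_quotient_subset: "spectrum (matrix_on P Q) \<subseteq> spectrum (matrix_on I M)"
proof
  fix k assume "k \<in> spectrum (matrix_on P Q)"
  then obtain y p where y: "p \<in> P" "y p \<noteq> 0" "\<And>p. p \<in> P \<Longrightarrow> mult_on P Q y p = k * y p"
    unfolding spectrum_matrix_on[OF finite_parts] mult_on_def by blast
  obtain i where "i \<in> p"
    using partition_onD3[OF partition] y(1) by fastforce
  with y have "i \<in> I" "y (part_of i) \<noteq> 0"
    using partition_onD1[OF partition] part_of_eq by auto
  moreover have "mult_on I M (\<lambda>i. y (part_of i)) i = k * y (part_of i)" if "i \<in> I" for i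
    using mult_on_lift[OF that] y(3)[OF part_of_in(1)[OF that]] by simp
  ultimately show "k \<in> spectrum (matrix_on I M)"
    unfolding spectrum_matrix_on[OF finite_index] mult_on_def mem_Collect_eq
    by (intro exI[of _ "\<lambda>i. y (part_of i)"]) auto
qed

end

lemma sum_in_nonneg_Reals: "(\<And>i. i \<in> A \<Longrightarrow> f i \<in> \<real>\<^sub>\<ge>\<^sub>0) \<Longrightarrow> sum f A \<in> \<real>\<^sub>\<ge>\<^sub>0"
  by (induction A rule: infinite_finite_induct) auto

lemma prod_in_nonneg_Reals:
  "(\<And>i. i \<in> A \<Longrightarrow> f i \<in> (\<real>\<^sub>\<ge>\<^sub>0 :: 'a :: {comm_monoid_mult, real_algebra_1} set)) \<Longrightarrow> prod f A \<in> \<real>\<^sub>\<ge>\<^sub>0"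
  by (induction A rule: infinite_finite_induct) auto

lemma norm_sum_nonneg_Reals:
  fixes f :: "'i \<Rightarrow> complex"
  assumes "\<And>i. i \<in> A \<Longrightarrow> f i \<in> \<real>\<^sub>\<ge>\<^sub>0"
  shows "norm (sum f A) = (\<Sum>i\<in>A. norm (f i))"
proof -
  have re: "norm z = Re z" if "z \<in> \<real>\<^sub>\<ge>\<^sub>0" for z :: complex
    using that by (auto elim!: nonneg_Reals_cases)
  have "norm (sum f A) = Re (sum f A)"
    using sum_in_nonneg_Reals[of A f] assms by (intro re) auto
  also have "\<dots> = (\<Sum>i\<in>A. norm (f i))"
    using assms by (auto simp: re Re_sum)
  finally show ?thesis .
qed

text \<open>
  Each application of the matrix turns the bound for step \<open>k\<close> into the one for step \<open>k + 1\<close>: on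
  the left through the triangle inequality in the eigenvalue equation, on the right with equality,
  because the iterates of the constant \<open>1\<close> are nonnegative.
\<close>

lemma eigenvector_le_iterate_one:
  fixes M :: "'i \<Rightarrow> 'i \<Rightarrow> complex"
  assumes nonneg: "\<And>i j. i \<in> I \<Longrightarrow> j \<in> I \<Longrightarrow> M i j \<in> \<real>\<^sub>\<ge>\<^sub>0"
    and ev: "\<And>i. i \<in> I \<Longrightarrow> mult_on I M x i = \<mu> * x i"
    and bound: "\<And>i. i \<in> I \<Longrightarrow> norm (x i) \<le> b"
    and i: "i \<in> I"
  shows "norm \<mu> ^ k * norm (x i) \<le> b * norm ((mult_on I M ^^ k) (\<lambda>_. 1) i)"
  using i
proof (induction k arbitrary: i)
  case 0
  then show ?case
    using bound by simp
next
  case (Suc k)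
  let ?y = "(mult_on I M ^^ k) (\<lambda>_. 1)"
  have y: "(mult_on I M ^^ k) (\<lambda>_. 1) j \<in> \<real>\<^sub>\<ge>\<^sub>0" if "j \<in> I" for j k
    using that
    by (induction k arbitrary: j)
      (auto simp: mult_on_def intro!: sum_in_nonneg_Reals nonneg_Reals_mult_I nonneg)
  have "norm \<mu> ^ Suc k * norm (x i) = norm \<mu> ^ k * norm (mult_on I M x i)"
    using ev[OF Suc.prems] by (simp add: norm_mult)
  also have "\<dots> \<le> norm \<mu> ^ k * (\<Sum>j\<in>I. norm (M i j * x j))"
    unfolding mult_on_def by (intro mult_left_mono norm_sum) auto
  also have "\<dots> = (\<Sum>j\<in>I. norm (M i j) * (norm \<mu> ^ k * norm (x j)))"
    by (simp add: sum_distrib_left norm_mult mult_ac)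
  also have "\<dots> \<le> (\<Sum>j\<in>I. norm (M i j) * (b * norm (?y j)))"
    by (intro sum_mono mult_left_mono Suc.IH) auto
  also have "\<dots> = b * (\<Sum>j\<in>I. norm (M i j * ?y j))"
    by (simp add: sum_distrib_left norm_mult mult_ac)
  also have "(\<Sum>j\<in>I. norm (M i j * ?y j)) = norm (mult_on I M ?y i)"
    unfolding mult_on_def[of I M ?y]
    by (rule norm_sum_nonneg_Reals[symmetric]) (intro nonneg_Reals_mult_I nonneg y Suc.prems)
  finally show ?case
    by simp
qed

text \<open>
  Eigenvectors lift from the quotient, which gives one inequality. For the other one, a larger
  spectral radius upstairs would make the iterates of the constant \<open>1\<close>, which live on the quotient,
  grow faster than the spectral radius of the quotient allows.
\<close>

theorem (in equitable_partition) spectral_radius_quotient: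
  assumes ne: "I \<noteq> {}" and nonneg: "\<And>i j. i \<in> I \<Longrightarrow> j \<in> I \<Longrightarrow> M i j \<in> \<real>\<^sub>\<ge>\<^sub>0"
  shows "spectral_radius (matrix_on I M) = spectral_radius (matrix_on P Q)" (is "?s = ?r")
proof (rule antisym)
  have "P \<noteq> {}"
    using ne partition_onD1[OF partition] by auto
  then obtain \<nu> where \<nu>: "\<nu> \<in> spectrum (matrix_on P Q)" "norm \<nu> = ?r"
    using spectral_radius_matrix_on_attained[OF finite_parts] by metis
  then show "?r \<le> ?s"
    using norm_le_spectral_radius_matrix_on[of \<nu> I M] spectrum_quotient_subset by auto
  show "?s \<le> ?r"
  proof (rule ccontr)
    assume "\<not> ?s \<le> ?r"
    moreover define t where "t = (?r + ?s) / 2"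
    moreover have "?r \<ge> 0"
      using \<nu>(2) norm_ge_zero by metis
    ultimately have t: "?r < t" "t < ?s" "t > 0"
      by auto
    obtain c where c: "\<And>k p. p \<in> P \<Longrightarrow> norm ((mult_on P Q ^^ k) (\<lambda>_. 1) p) \<le> c * t ^ k"
      using mult_on_funpow_growth[OF finite_parts t(1,3)] by metis
    obtain \<mu> where \<mu>: "\<mu> \<in> spectrum (matrix_on I M)" "norm \<mu> = ?s"
      using spectral_radius_matrix_on_attained[OF finite_index ne] by metis
    then obtain x i where x: "i \<in> I" "x i \<noteq> 0"
      "\<And>i. i \<in> I \<Longrightarrow> mult_on I M x i = \<mu> * x i"
      unfolding spectrum_matrix_on[OF finite_index] mult_on_def by blast
    define b where "b = (\<Sum>j\<in>I. norm (x j))"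
    have b: "norm (x j) \<le> b" if "j \<in> I" for j
      unfolding b_def using finite_index that by (intro member_le_sum) auto
    then have "b \<ge> 0"
      using x(1) norm_ge_zero order_trans by blast
    have le: "(?s / t) ^ k * norm (x i) \<le> b * c" for k
    proof -
      have "?s ^ k * norm (x i) \<le> b * norm ((mult_on I M ^^ k) (\<lambda>_. 1) i)"
        using eigenvector_le_iterate_one[OF nonneg x(3) b x(1)] \<mu>(2) by simp
      also have "(mult_on I M ^^ k) (\<lambda>_. 1) i = (mult_on P Q ^^ k) (\<lambda>_. 1) (part_of i)"
        using mult_on_funpow_lift[OF x(1), of k "\<lambda>_. 1"] by simp
      also have "b * norm \<dots> \<le> b * (c * t ^ k)"
        using c[OF part_of_in(1)[OF x(1)]] \<open>b \<ge> 0\<close> by (intro mult_left_mono)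
      finally show ?thesis
        using t(3) by (simp add: power_divide field_simps)
    qed
    obtain k where "b * c / norm (x i) < (?s / t) ^ k"
      using real_arch_pow[of "?s / t"] t by auto
    with le[of k] x(2) show False
      by (simp add: field_simps)
  qed
qed


section \<open>Orbits as an equitable partition\<close>

text \<open>
  A family of maps that contains an identity and is closed under composition and inverses, all
  understood on \<open>E\<close> only. Maps such as images of subsets are not extensional on the set they act
  on, so a homomorphism into the group of extensional bijections would require restrictions
  throughout; the properties below suffice for orbits to behave as expected.
\<close>

locale transformation_group =
  fixes G :: "('g, 'm) monoid_scheme" and E :: "'e set" and act :: "'g \<Rightarrow> 'e \<Rightarrow> 'e"
  assumes act_closed: "\<And>g x. g \<in> carrier G \<Longrightarrow> x \<in> E \<Longrightarrow> act g x \<in> E"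
    and act_id: "\<exists>g\<in>carrier G. \<forall>x\<in>E. act g x = x"
    and act_comp: "\<And>g h. g \<in> carrier G \<Longrightarrow> h \<in> carrier G \<Longrightarrow>
      \<exists>k\<in>carrier G. \<forall>x\<in>E. act k x = act g (act h x)"
    and act_inv: "\<And>g. g \<in> carrier G \<Longrightarrow>
      \<exists>h\<in>carrier G. \<forall>x\<in>E. act h (act g x) = x \<and> act g (act h x) = x"
begin

lemma act_bij:
  assumes g: "g \<in> carrier G"
  shows "bij_betw (act g) E E"
proof -
  obtain h where h: "h \<in> carrier G" "\<forall>x\<in>E. act h (act g x) = x \<and> act g (act h x) = x"
    using act_inv[OF g] by blast
  then show ?thesis
    using act_closed[OF g] act_closed[OF h(1)]
    by (intro bij_betw_byWitness[where f' = "act h"]) auto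
qed

lemma orbit_eq:
  assumes g: "g \<in> carrier G" and x: "x \<in> E"
  shows "orbit G act (act g x) = orbit G act x"
proof
  have "\<exists>k'\<in>carrier G. act k (act g x) = act k' x" if "k \<in> carrier G" for k
    using act_comp[OF that g] x by metis
  then show "orbit G act (act g x) \<subseteq> orbit G act x"
    unfolding orbit_def by auto
  obtain h where h: "h \<in> carrier G" "act h (act g x) = x"
    using act_inv[OF g] x by blast
  have "\<exists>k'\<in>carrier G. act k x = act k' (act g x)" if "k \<in> carrier G" for k
    using act_comp[OF that h(1)] act_closed[OF g x] h(2) by metis
  then show "orbit G act x \<subseteq> orbit G act (act g x)"
    unfolding orbit_def by auto
qed

lemma orbit_eqI:
  assumes "p \<in> orbits G E act" "z \<in> p"
  shows "p = orbit G act z"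
proof -
  obtain w k where "w \<in> E" "p = orbit G act w" "k \<in> carrier G" "z = act k w"
    using assms unfolding orbits_def orbit_def by auto
  then show ?thesis
    using orbit_eq by simp
qed

lemma partition_on_orbits: "partition_on E (orbits G E act)"
proof (rule partition_onI)
  have self: "x \<in> orbit G act x" if "x \<in> E" for x
    using act_id that unfolding orbit_def by force
  moreover have "p \<subseteq> E" if "p \<in> orbits G E act" for p
    using that act_closed by (auto simp: orbits_def orbit_def)
  ultimately show "\<Union> (orbits G E act) = E"
    unfolding orbits_def by blast
  show "{} \<notin> orbits G E act"
    using self unfolding orbits_def by fastforce
  have "p = orbit G act z" if "p \<in> orbits G E act" "z \<in> p" for p z
    using that by (rule orbit_eqI)
  then show "disjnt p q" if "p \<in> orbits G E act" "q \<in> orbits G E act" "p \<noteq> q" for p q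
    using that unfolding disjnt_iff by metis
qed

lemma orbit_bij:
  assumes h: "h \<in> carrier G" and q: "q \<in> orbits G E act"
  shows "bij_betw (act h) q q"
proof -
  obtain x where x: "x \<in> E" "q = orbit G act x"
    using q unfolding orbits_def by blast
  have "q \<subseteq> E"
    using x by (auto simp: orbit_def intro: act_closed)
  have closed: "act k y \<in> q" if "k \<in> carrier G" "y \<in> q" for k y
    using orbit_eqI[OF q that(2)] that(1) by (auto simp: orbit_def)
  obtain k where k: "k \<in> carrier G" "\<And>y. y \<in> E \<Longrightarrow> act k (act h y) = y \<and> act h (act k y) = y"
    using act_inv[OF h] by blast
  show ?thesis
    by (rule bij_betw_byWitness[where f' = "act k"])
      (use closed h k \<open>q \<subseteq> E\<close> in auto)
qed

text \<open>
  The column move \<open>h\<close> accompanying a row move \<open>g\<close> may differ from \<open>g\<close>: being in the group, it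
  only rearranges the sum over an orbit of columns.
\<close>

lemma equitable_partition_orbits:
  assumes "finite E"
    and twist: "\<And>g. g \<in> carrier G \<Longrightarrow>
      \<exists>h\<in>carrier G. \<forall>x\<in>E. \<forall>y\<in>E. M (act g x) (act h y) = M x y"
  shows "equitable_partition E (orbits G E act) M (\<lambda>p q. \<Sum>y\<in>q. M (SOME x. x \<in> p) y)"
proof
  fix p q x assume p: "p \<in> orbits G E act" and q: "q \<in> orbits G E act" and x: "x \<in> p"
  have sub: "p \<subseteq> E" "q \<subseteq> E"
    using partition_onD1[OF partition_on_orbits] p q by auto
  define z where "z = (SOME x. x \<in> p)"
  have z: "z \<in> p"
    unfolding z_def using x by (rule someI)
  have "p = orbit G act z"
    using p z by (rule orbit_eqI)
  then obtain g where g: "g \<in> carrier G" "x = act g z"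
    using x unfolding orbit_def by auto
  obtain h where h: "h \<in> carrier G" "\<forall>x\<in>E. \<forall>y\<in>E. M (act g x) (act h y) = M x y"
    using twist[OF g(1)] by blast
  have "(\<Sum>y\<in>q. M x y) = (\<Sum>y\<in>q. M x (act h y))"
    by (rule sum.reindex_bij_betw[OF orbit_bij[OF h(1) q], symmetric])
  also have "\<dots> = (\<Sum>y\<in>q. M z y)"
    using g(2) h(2) sub z by (intro sum.cong) auto
  finally show "(\<Sum>y\<in>q. M x y) = (\<Sum>y\<in>q. M (SOME x. x \<in> p) y)"
    by (simp add: z_def)
qed (use assms partition_on_orbits in auto)

lemma transformation_group_Pow: "transformation_group G (Pow E) (\<lambda>g U. act g ` U)"
proof
  show "\<exists>g\<in>carrier G. \<forall>U\<in>Pow E. act g ` U = U"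
  proof -
    obtain g where "g \<in> carrier G" "\<forall>x\<in>E. act g x = x"
      using act_id by blast
    then show ?thesis
      by (intro bexI[of _ g]) force+
  qed
  show "\<exists>k\<in>carrier G. \<forall>U\<in>Pow E. act k ` U = act g ` act h ` U"
    if gh: "g \<in> carrier G" "h \<in> carrier G" for g h
  proof -
    obtain k where "k \<in> carrier G" "\<forall>x\<in>E. act k x = act g (act h x)"
      using act_comp[OF gh] by blast
    then show ?thesis
      by (intro bexI[of _ k]) (auto simp: image_image intro!: image_cong)
  qed
  show "\<exists>h\<in>carrier G. \<forall>U\<in>Pow E. act h ` act g ` U = U \<and> act g ` act h ` U = U"
    if g: "g \<in> carrier G" for g
  proof -
    obtain h where h: "h \<in> carrier G" "\<forall>x\<in>E. act h (act g x) = x \<and> act g (act h x) = x"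
      using act_inv[OF g] by blast
    have "(\<lambda>x. act h (act g x)) ` U = (\<lambda>x. x) ` U \<and> (\<lambda>x. act g (act h x)) ` U = (\<lambda>x. x) ` U"
      if "U \<subseteq> E" for U
      using h(2) that by (intro conjI image_cong) auto
    then have "act h ` act g ` U = U \<and> act g ` act h ` U = U" if "U \<subseteq> E" for U
      using that by (simp add: image_image)
    with h(1) show ?thesis
      by (intro bexI[of _ h] ballI) auto
  qed
qed (auto intro: act_closed)

end


section \<open>Affine maps preserving a set of directions up to translation\<close>

context comm_group
begin

text \<open>
  The automorphisms that map \<open>D\<close> to one of its translates. They are the linear parts of the affine
  maps considered here.
\<close>

definition shape_stab :: "'a set \<Rightarrow> ('a \<Rightarrow> 'a) set" where
  "shape_stab D = {\<phi> \<in> auto G. \<exists>t\<in>carrier G. \<phi> ` D = t <# D}"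

lemma autoD:
  assumes "\<phi> \<in> auto G"
  shows "x \<in> carrier G \<Longrightarrow> \<phi> x \<in> carrier G"
    and "x \<in> carrier G \<Longrightarrow> y \<in> carrier G \<Longrightarrow> \<phi> (x \<otimes> y) = \<phi> x \<otimes> \<phi> y"
    and "x \<in> carrier G \<Longrightarrow> \<phi> (inv x) = inv (\<phi> x)"
    and "bij_betw \<phi> (carrier G) (carrier G)"
proof -
  have h: "\<phi> \<in> hom G G"
    using assms by (simp add: auto_def)
  then interpret group_hom G G \<phi>
    by unfold_locales
  show "x \<in> carrier G \<Longrightarrow> \<phi> x \<in> carrier G"
    and "x \<in> carrier G \<Longrightarrow> y \<in> carrier G \<Longrightarrow> \<phi> (x \<otimes> y) = \<phi> x \<otimes> \<phi> y"
    and "x \<in> carrier G \<Longrightarrow> \<phi> (inv x) = inv (\<phi> x)"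
    by auto
  show "bij_betw \<phi> (carrier G) (carrier G)"
    using assms by (simp add: auto_def Bij_def)
qed

lemma auto_image_l_coset:
  assumes "\<phi> \<in> auto G" "t \<in> carrier G" "D \<subseteq> carrier G"
  shows "\<phi> ` (t <# D) = \<phi> t <# (\<phi> ` D)"
proof -
  have "\<phi> ` (t <# D) = (\<Union>d\<in>D. {\<phi> (t \<otimes> d)})"
    by (simp add: l_coset_def image_UN)
  also have "\<dots> = (\<Union>d\<in>D. {\<phi> t \<otimes> \<phi> d})"
    using assms by (intro SUP_cong refl) (auto simp: autoD(2)[OF assms(1)])
  also have "\<dots> = \<phi> t <# (\<phi> ` D)"
    by (simp add: l_coset_def)
  finally show ?thesis .
qed

text \<open>If \<open>\<phi> D = s + D\<close> and \<open>\<psi> D = t + D\<close>, then \<open>\<phi> (\<psi> D) = \<phi> t + s + D\<close>.\<close>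

lemma compose_in_shape_stab:
  assumes D: "D \<subseteq> carrier G" and \<phi>: "\<phi> \<in> shape_stab D" and \<psi>: "\<psi> \<in> shape_stab D"
  shows "compose (carrier G) \<phi> \<psi> \<in> shape_stab D"
proof -
  from \<phi> \<psi> obtain s t where s: "\<phi> \<in> auto G" "s \<in> carrier G" "\<phi> ` D = s <# D"
    and t: "\<psi> \<in> auto G" "t \<in> carrier G" "\<psi> ` D = t <# D"
    by (auto simp: shape_stab_def)
  have "compose (carrier G) \<phi> \<psi> ` D = \<phi> ` \<psi> ` D"
    using D by (auto simp: compose_def image_image intro!: image_cong)
  also have "\<dots> = (\<phi> t \<otimes> s) <# D"
    using s t D autoD(1)[OF s(1)] by (simp add: auto_image_l_coset lcos_m_assoc)
  finally have "compose (carrier G) \<phi> \<psi> ` D = (\<phi> t \<otimes> s) <# D" .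
  moreover have "compose (carrier G) \<phi> \<psi> \<in> auto G"
    using s(1) t(1) by (auto simp: auto_def compose_Bij hom_compose)
  ultimately show ?thesis
    using s t autoD(1)[OF s(1)] by (auto simp: shape_stab_def)
qed

lemma id_in_shape_stab:
  assumes D: "D \<subseteq> carrier G"
  shows "(\<lambda>x\<in>carrier G. x) \<in> shape_stab D"
proof -
  have "(\<lambda>x\<in>carrier G. x) ` D = \<one> <# D"
  proof -
    have "(\<lambda>x\<in>carrier G. x) ` D = (\<lambda>x. x) ` D"
      using D by (intro image_cong) auto
    then show ?thesis
      by (simp add: lcos_mult_one[OF D])
  qed
  then show ?thesis
    using id_in_auto unfolding shape_stab_def by blast
qed

text \<open>Applying \<open>\<psi> = \<phi>\<inverse>\<close> to \<open>\<phi> D = t + D\<close> gives \<open>D = \<psi> t + \<psi> D\<close>, so \<open>\<psi> D = - \<psi> t + D\<close>.\<close>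

lemma inv_in_shape_stab:
  assumes D: "D \<subseteq> carrier G" and \<phi>: "\<phi> \<in> shape_stab D"
  obtains \<psi> where "\<psi> \<in> shape_stab D"
    "\<And>x. x \<in> carrier G \<Longrightarrow> \<psi> (\<phi> x) = x" "\<And>x. x \<in> carrier G \<Longrightarrow> \<phi> (\<psi> x) = x"
proof -
  from \<phi> obtain t where t: "\<phi> \<in> auto G" "t \<in> carrier G" "\<phi> ` D = t <# D"
    by (auto simp: shape_stab_def)
  define \<psi> where "\<psi> = restrict (inv_into (carrier G) \<phi>) (carrier G)"
  have \<psi>: "\<psi> \<in> auto G"
    using t(1) by (simp add: \<psi>_def auto_def restrict_inv_into_hom restrict_inv_into_Bij del: restrict_apply)
  have inv1: "\<psi> (\<phi> x) = x" if "x \<in> carrier G" for x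
    using that autoD(1,4)[OF t(1)] by (simp add: \<psi>_def bij_betw_inv_into_left)
  have inv2: "\<phi> (\<psi> x) = x" if "x \<in> carrier G" for x
    using that autoD(4)[OF t(1)] by (simp add: \<psi>_def bij_betw_inv_into_right)
  have c: "\<psi> t \<in> carrier G" "\<psi> ` D \<subseteq> carrier G"
    using D t(2) autoD(1)[OF \<psi>] by auto
  have "\<psi> ` \<phi> ` D = (\<lambda>x. x) ` D"
    unfolding image_image using D inv1 by (intro image_cong) auto
  then have "D = \<psi> ` \<phi> ` D"
    by simp
  also have "\<dots> = \<psi> t <# (\<psi> ` D)"
    using D t by (simp add: auto_image_l_coset[OF \<psi>])
  finally have "inv (\<psi> t) <# D = inv (\<psi> t) <# (\<psi> t <# (\<psi> ` D))"
    by simp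
  also have "\<dots> = \<psi> ` D"
    using c by (simp add: lcos_m_assoc lcos_mult_one)
  finally have "\<psi> \<in> shape_stab D"
    using \<psi> c by (auto simp: shape_stab_def)
  then show ?thesis
    using inv1 inv2 that by blast
qed

text \<open>
  Written additively: \<open>w - v\<close> lies in \<open>D\<close> if and only if \<open>\<phi> w - \<phi> v\<close> lies in \<open>\<phi> D = t + D\<close>, and
  the extra translation of the second point by \<open>- t\<close> brings the difference back to \<open>D\<close>.
\<close>

lemma shape_stab_difference:
  assumes D: "D \<subseteq> carrier G" and \<phi>: "\<phi> \<in> auto G" "t \<in> carrier G" "\<phi> ` D = t <# D"
    and c: "u \<in> carrier G" "v \<in> carrier G" "w \<in> carrier G"
  shows "((u \<otimes> inv t) \<otimes> \<phi> w) \<otimes> inv (u \<otimes> \<phi> v) \<in> D \<longleftrightarrow> w \<otimes> inv v \<in> D"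
proof -
  note [simp] = autoD(1)[OF \<phi>(1)]
  let ?d = "((u \<otimes> inv t) \<otimes> \<phi> w) \<otimes> inv (u \<otimes> \<phi> v)"
  have "t \<otimes> ?d = (t \<otimes> inv t) \<otimes> (u \<otimes> inv u) \<otimes> (\<phi> w \<otimes> inv (\<phi> v))"
    by (simp only: inv_mult m_ac m_closed inv_closed autoD(1)[OF \<phi>(1)] c \<phi>(2))
  also have "\<dots> = \<phi> (w \<otimes> inv v)"
    using c \<phi>(2) by (simp add: autoD(2,3)[OF \<phi>(1)])
  finally have eq: "t \<otimes> ?d = \<phi> (w \<otimes> inv v)" .
  have "?d \<in> D \<longleftrightarrow> t \<otimes> ?d \<in> t <# D"
  proof -
    have "t <# D = (\<otimes>) t ` D"
      by (auto simp: l_coset_def)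
    then show ?thesis
      using inj_on_image_mem_iff[OF inj_on_cmult[OF \<phi>(2)], of ?d D] D c \<phi>(2) by simp
  qed
  also have "\<dots> \<longleftrightarrow> \<phi> (w \<otimes> inv v) \<in> \<phi> ` D"
    by (simp add: eq \<phi>(3))
  also have "\<dots> \<longleftrightarrow> w \<otimes> inv v \<in> D"
    using D c autoD(4)[OF \<phi>(1)] by (intro inj_on_image_mem_iff) (auto simp: bij_betw_def)
  finally show ?thesis .
qed

end


section \<open>Symmetries of the transfer matrix\<close>

text \<open>Conjugation with \<open>f\<close> and \<open>h\<close> matches the bijections that the two permanents sum over.\<close>

lemma permanent_reindex:
  assumes f: "inj_on f R" and h: "inj_on h C"
  shows "permanent A (f ` R) (h ` C) = permanent (\<lambda>u v. A (f u) (h v)) R C"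
proof -
  let ?S = "{\<sigma> \<in> R \<rightarrow>\<^sub>E C. bij_betw \<sigma> R C}"
  let ?S' = "{\<sigma> \<in> f ` R \<rightarrow>\<^sub>E h ` C. bij_betw \<sigma> (f ` R) (h ` C)}"
  let ?f' = "inv_into R f" and ?h' = "inv_into C h"
  let ?F = "\<lambda>\<sigma>. restrict (h \<circ> \<sigma> \<circ> ?f') (f ` R)"
  let ?F' = "\<lambda>\<tau>. restrict (?h' \<circ> \<tau> \<circ> f) R"
  have bf: "bij_betw f R (f ` R)" "bij_betw ?f' (f ` R) R"
    and bh: "bij_betw h C (h ` C)" "bij_betw ?h' (h ` C) C"
    using f h by (auto simp: bij_betw_def inj_on_inv_into)
  have F: "?F \<sigma> \<in> ?S'" if "\<sigma> \<in> ?S" for \<sigma>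
  proof -
    have "bij_betw (?F \<sigma>) (f ` R) (h ` C)"
      using that bf bh by (subst bij_betw_restrict_eq) (auto intro!: bij_betw_trans)
    then show ?thesis
      by (auto dest: bij_betw_imp_funcset)
  qed
  have F': "?F' \<tau> \<in> ?S" if "\<tau> \<in> ?S'" for \<tau>
  proof -
    have "bij_betw (?F' \<tau>) R C"
      using that bf bh by (subst bij_betw_restrict_eq) (auto intro!: bij_betw_trans)
    then show ?thesis
      by (auto dest: bij_betw_imp_funcset)
  qed
  show ?thesis
    unfolding permanent_def
  proof (rule sum.reindex_bij_witness[of _ ?F ?F'])
    fix \<tau> assume \<tau>: "\<tau> \<in> ?S'"
    show "?F' \<tau> \<in> ?S"
      by (rule F'[OF \<tau>])
    show "?F (?F' \<tau>) = \<tau>"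
      using \<tau> f by (intro extensionalityI[of _ "f ` R"])
        (auto simp: PiE_def inv_into_f_f f_inv_into_f Pi_iff)
    show "(\<Prod>u\<in>R. A (f u) (h (?F' \<tau> u))) = (\<Prod>u\<in>f ` R. A u (\<tau> u))"
      using \<tau> f by (auto simp: prod.reindex PiE_def Pi_iff f_inv_into_f intro!: prod.cong)
  next
    fix \<sigma> assume \<sigma>: "\<sigma> \<in> ?S"
    show "?F \<sigma> \<in> ?S'"
      by (rule F[OF \<sigma>])
    show "?F' (?F \<sigma>) = \<sigma>"
      using \<sigma> f h by (intro extensionalityI[of _ R])
        (auto simp: PiE_def inv_into_f_f Pi_iff)
  qed
qed

lemma torus_comm_group: "comm_group (torus m n)"
proof -
  have "group (torus m n)"
    by (simp add: torus_def DirProd_group)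
  moreover have "comm_group (integer_mod_group k)" for k
    by simp
  ultimately show ?thesis
    by (intro group.group_comm_groupI)
      (auto simp: torus_def integer_mod_group_def integer_group_def add.commute)
qed

lemma finite_torus: "m > 0 \<Longrightarrow> n > 0 \<Longrightarrow> finite (carrier (torus m n))"
  by (simp add: torus_def carrier_integer_mod_group)

lemma dirs_subset: "m \<ge> 2 \<Longrightarrow> n \<ge> 2 \<Longrightarrow> dirs \<subseteq> carrier (torus m n)"
  by (auto simp: dirs_def torus_def carrier_integer_mod_group)

lemma dirs_stab_eq: "dirs_stab m n = comm_group.shape_stab (torus m n) dirs"
  by (simp add: dirs_stab_def comm_group.shape_stab_def[OF torus_comm_group])

lemma carrier_sym_group: "carrier (sym_group m n) = carrier (torus m n) \<times> dirs_stab m n"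
  by (simp add: sym_group_def)

lemma transformation_group_sym_act:
  assumes D: "dirs \<subseteq> carrier (torus m n)"
  shows "transformation_group (sym_group m n) (carrier (torus m n)) (sym_act m n)"
proof -
  interpret comm_group "torus m n"
    by (rule torus_comm_group)
  let ?V = "carrier (torus m n)" and ?K = "shape_stab dirs"
  have K: "\<phi> \<in> auto (torus m n)" if "\<phi> \<in> ?K" for \<phi>
    using that by (simp add: shape_stab_def)
  show ?thesis
  proof
    show "sym_act m n g x \<in> ?V" if "g \<in> carrier (sym_group m n)" "x \<in> ?V" for g x
    proof -
      obtain u \<phi> where "g = (u, \<phi>)" "u \<in> ?V" "\<phi> \<in> ?K"
        using \<open>g \<in> carrier (sym_group m n)\<close> by (auto simp: carrier_sym_group dirs_stab_eq)
      then show ?thesis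
        using autoD(1)[OF K] \<open>x \<in> ?V\<close> by (simp add: sym_act_def del: split_paired_All)
    qed
    show "\<exists>g\<in>carrier (sym_group m n). \<forall>x\<in>?V. sym_act m n g x = x"
      by (rule bexI[of _ "(\<one>\<^bsub>torus m n\<^esub>, \<lambda>x\<in>?V. x)"])
        (use id_in_shape_stab[OF D] in
          \<open>auto simp: carrier_sym_group dirs_stab_eq sym_act_def\<close>)
  next
    fix g h assume "g \<in> carrier (sym_group m n)" "h \<in> carrier (sym_group m n)"
    then obtain u \<phi> v \<psi> where gh: "g = (u, \<phi>)" "h = (v, \<psi>)" "u \<in> ?V" "v \<in> ?V" "\<phi> \<in> ?K" "\<psi> \<in> ?K"
      by (auto simp: carrier_sym_group dirs_stab_eq)
    have "sym_act m n (u \<otimes>\<^bsub>torus m n\<^esub> \<phi> v, compose ?V \<phi> \<psi>) x = sym_act m n g (sym_act m n h x)"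
      if "x \<in> ?V" for x
      using that gh autoD(1,2)[OF K[OF gh(5)]] autoD(1)[OF K[OF gh(6)]]
      by (simp add: sym_act_def compose_def m_assoc)
    moreover have "(u \<otimes>\<^bsub>torus m n\<^esub> \<phi> v, compose ?V \<phi> \<psi>) \<in> carrier (sym_group m n)"
      using gh autoD(1)[OF K[OF gh(5)]] compose_in_shape_stab[OF D gh(5,6)]
      by (simp add: carrier_sym_group dirs_stab_eq)
    ultimately show "\<exists>k\<in>carrier (sym_group m n). \<forall>x\<in>?V. sym_act m n k x = sym_act m n g (sym_act m n h x)"
      by (intro bexI ballI)
  next
    fix g assume "g \<in> carrier (sym_group m n)"
    then obtain u \<phi> where g: "g = (u, \<phi>)" "u \<in> ?V" "\<phi> \<in> ?K"
      by (auto simp: carrier_sym_group dirs_stab_eq)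
    from inv_in_shape_stab[OF D g(3)] obtain \<psi> where \<psi>: "\<psi> \<in> ?K"
      "\<And>x. x \<in> ?V \<Longrightarrow> \<psi> (\<phi> x) = x" "\<And>x. x \<in> ?V \<Longrightarrow> \<phi> (\<psi> x) = x"
      by blast
    note [simp] = autoD(1-3)[OF K[OF g(3)]] autoD(1-3)[OF K[OF \<psi>(1)]]
    let ?h = "(inv\<^bsub>torus m n\<^esub> (\<psi> u), \<psi>)"
    have "?h \<in> carrier (sym_group m n)"
      using g \<psi> by (simp add: carrier_sym_group dirs_stab_eq)
    moreover have "sym_act m n ?h (sym_act m n g x) = x \<and> sym_act m n g (sym_act m n ?h x) = x"
      if "x \<in> ?V" for x
      using that g \<psi> by (simp add: sym_act_def m_assoc[symmetric])
    ultimately show "\<exists>h\<in>carrier (sym_group m n). \<forall>x\<in>?V.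
        sym_act m n h (sym_act m n g x) = x \<and> sym_act m n g (sym_act m n h x) = x"
      by (intro bexI[of _ ?h] ballI)
  qed
qed

text \<open>
  For \<open>g = (u, \<phi>)\<close> and \<open>h = (u - t, \<phi>)\<close> the adjacency matrix satisfies \<open>A (g v) (h w) = A v w\<close>.
  As \<open>h\<close> is a bijection of the torus, it commutes with complements of column sets, so the
  permanents agree.
\<close>

lemma transfer_twist:
  assumes D: "dirs \<subseteq> carrier (torus m n)" and g: "g \<in> carrier (sym_group m n)"
  shows "\<exists>h\<in>carrier (sym_group m n). \<forall>U\<in>Pow (carrier (torus m n)). \<forall>V\<in>Pow (carrier (torus m n)).
    transfer m n (sym_act m n g ` U) (sym_act m n h ` V) = transfer m n U V"
proof -
  interpret comm_group "torus m n"
    by (rule torus_comm_group)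
  interpret transformation_group "sym_group m n" "carrier (torus m n)" "sym_act m n"
    by (rule transformation_group_sym_act[OF D])
  let ?V = "carrier (torus m n)"
  from g obtain u \<phi> where g: "g = (u, \<phi>)" "u \<in> ?V" "\<phi> \<in> shape_stab dirs"
    by (auto simp: carrier_sym_group dirs_stab_eq)
  from g(3) obtain t
    where \<phi>: "\<phi> \<in> auto (torus m n)" "t \<in> ?V" "\<phi> ` dirs = t <#\<^bsub>torus m n\<^esub> dirs"
    unfolding shape_stab_def by blast
  define h where "h = (u \<otimes>\<^bsub>torus m n\<^esub> inv\<^bsub>torus m n\<^esub> t, \<phi>)"
  have mem: "g \<in> carrier (sym_group m n)" "h \<in> carrier (sym_group m n)"
    using g \<phi> by (auto simp: h_def carrier_sym_group dirs_stab_eq)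
  have adj: "adj m n (sym_act m n g v) (sym_act m n h w) = adj m n v w"
    if "v \<in> ?V" "w \<in> ?V" for v w
    using shape_stab_difference[OF D \<phi> g(2) that] by (simp add: adj_def sym_act_def h_def g)
  have "transfer m n (sym_act m n g ` U) (sym_act m n h ` V) = transfer m n U V"
    if U: "U \<subseteq> ?V" and V: "V \<subseteq> ?V" for U V
  proof -
    have inj: "inj_on (sym_act m n g) U" "inj_on (sym_act m n h) V"
      "inj_on (sym_act m n h) (?V - V)"
      using act_bij[OF mem(1)] act_bij[OF mem(2)] U V
      by (auto simp: bij_betw_def intro: inj_on_subset)
    have "?V - sym_act m n h ` V = sym_act m n h ` (?V - V)"
      using act_bij[OF mem(2)] V by (simp add: bij_betw_def inj_on_image_set_diff[where C = ?V])
    then have "permanent (adj m n) (sym_act m n g ` U) (?V - sym_act m n h ` V) =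
        permanent (\<lambda>v w. adj m n (sym_act m n g v) (sym_act m n h w)) U (?V - V)"
      by (simp add: permanent_reindex inj)
    also have "\<dots> = permanent (adj m n) U (?V - V)"
      unfolding permanent_def using U
      by (intro sum.cong prod.cong refl adj) (auto simp: PiE_def Pi_iff)
    finally show ?thesis
      by (simp add: transfer_def card_image inj)
  qed
  with mem(2) show ?thesis
    by (intro bexI[of _ h] ballI) simp_all
qed

lemma transfer_nonneg: "transfer m n U V \<in> \<real>\<^sub>\<ge>\<^sub>0"
  by (auto simp: transfer_def permanent_def adj_def intro!: sum_in_nonneg_Reals prod_in_nonneg_Reals)

theorem proposition3p2:
  fixes m n :: nat
  assumes "m \<ge> 2" and "n \<ge> 2"
  shows "spectral_radius (transfer_mat m n) = spectral_radius (compressed_transfer_mat m n)"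
proof -
  let ?V = "carrier (torus m n)"
  have D: "dirs \<subseteq> ?V"
    using assms by (rule dirs_subset)
  interpret transformation_group "sym_group m n" "Pow ?V" "\<lambda>g U. sym_act m n g ` U"
    by (intro transformation_group.transformation_group_Pow transformation_group_sym_act D)
  interpret equitable_partition "Pow ?V" "subset_orbits m n" "transfer m n" "compressed_transfer m n"
    unfolding subset_orbits_def compressed_transfer_def
    using assms transfer_twist[OF D] by (intro equitable_partition_orbits) (auto intro!: finite_torus)
  show ?thesis
    unfolding transfer_mat_def compressed_transfer_mat_def
    by (rule spectral_radius_quotient) (auto simp: transfer_nonneg)
qed

end
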